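(* In the planar four-body problem there are no central configurations with positive masses at the vertices of a $3$-sides equal trapezoid, excluding the square.
   Context: A configuration $(q_1,\dots,q_4)$ of pairwise distinct points of $\mathbb{R}^2$ with positive masses $m_1,\dots,m_4$ is a central configuration if there is $\lambda>0$ with $\sum_{j\ne k} m_j\,(q_j-q_k)/\|q_j-q_k\|^3=-\lambda\,(q_k-\mathbf{c})$ for all $k$, where $\mathbf{c}=\sum m_kq_k/\sum m_k$. A trapezoid is a non-degenerate convex quadrilateral with at least one pair of parallel sides (the bases; the other two sides are the lateral sides). An isosceles trapezoid is one whose lateral sides have the same length and whose base angles have the same measure (so its diagonals have equal length). A $3$-sides equal trapezoid is an isosceles trapezoid with three sides of the same length. *)

theory Defs
  imports "HOL-Analysis.Analysis"
begin

definition center_of_mass :: "('n::finite \<Rightarrow> real) \<Rightarrow> ('n \<Rightarrow> real^2) \<Rightarrow> real^2" where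
  "center_of_mass m q = (\<Sum>k\<in>UNIV. m k *\<^sub>R q k) /\<^sub>R (\<Sum>k\<in>UNIV. m k)"

definition central_configuration :: "('n::finite \<Rightarrow> real) \<Rightarrow> ('n \<Rightarrow> real^2) \<Rightarrow> bool" where
  "central_configuration m q \<longleftrightarrow>
     inj q \<and>
     (\<exists>l>0. \<forall>k. (\<Sum>j\<in>UNIV - {k}. (m j / norm (q j - q k) ^ 3) *\<^sub>R (q j - q k))
                 = - l *\<^sub>R (q k - center_of_mass m q))"

definition vertex_angle :: "real^2 \<Rightarrow> real^2 \<Rightarrow> real^2 \<Rightarrow> real" where
  "vertex_angle A B C = arccos (((A - B) \<bullet> (C - B)) / (norm (A - B) * norm (C - B)))"

text \<open>The vertices are listed in cyclic order, so that the sides are \<open>AB\<close>, \<open>BC\<close>, \<open>CD\<close>, \<open>DA\<close>.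
  Requiring all four points to be extreme points of the hull excludes degenerate quadrilaterals
  (three collinear vertices); requiring the sides to be edges of the hull excludes
  self-intersecting ones, and distinctness excludes triangles.\<close>

definition convex_quadrilateral :: "real^2 \<Rightarrow> real^2 \<Rightarrow> real^2 \<Rightarrow> real^2 \<Rightarrow> bool" where
  "convex_quadrilateral A B C D \<longleftrightarrow>
     distinct [A, B, C, D] \<and>
     (\<forall>P\<in>{A, B, C, D}. P extreme_point_of convex hull {A, B, C, D}) \<and>
     closed_segment A B edge_of convex hull {A, B, C, D} \<and>
     closed_segment B C edge_of convex hull {A, B, C, D} \<and>
     closed_segment C D edge_of convex hull {A, B, C, D} \<and>
     closed_segment D A edge_of convex hull {A, B, C, D}"

text \<open>Convention: the bases are \<open>AB\<close> and \<open>CD\<close>, the lateral sides are \<open>BC\<close> and \<open>DA\<close>.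
  Every trapezoid has this form after cyclically renaming its vertices.\<close>

definition trapezoid :: "real^2 \<Rightarrow> real^2 \<Rightarrow> real^2 \<Rightarrow> real^2 \<Rightarrow> bool" where
  "trapezoid A B C D \<longleftrightarrow>
     convex_quadrilateral A B C D \<and> affine_parallel (affine hull {A, B}) (affine hull {C, D})"

definition isosceles_trapezoid :: "real^2 \<Rightarrow> real^2 \<Rightarrow> real^2 \<Rightarrow> real^2 \<Rightarrow> bool" where
  "isosceles_trapezoid A B C D \<longleftrightarrow>
     trapezoid A B C D \<and> dist B C = dist D A \<and>
     vertex_angle D A B = vertex_angle A B C \<and> vertex_angle B C D = vertex_angle C D A"

definition three_sides_equal_trapezoid :: "real^2 \<Rightarrow> real^2 \<Rightarrow> real^2 \<Rightarrow> real^2 \<Rightarrow> bool" where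
  "three_sides_equal_trapezoid A B C D \<longleftrightarrow>
     isosceles_trapezoid A B C D \<and>
     (\<exists>s. count_list [dist A B, dist B C, dist C D, dist D A] s \<ge> 3)"

definition square :: "real^2 \<Rightarrow> real^2 \<Rightarrow> real^2 \<Rightarrow> real^2 \<Rightarrow> bool" where
  "square A B C D \<longleftrightarrow>
     convex_quadrilateral A B C D \<and>
     dist A B = dist B C \<and> dist B C = dist C D \<and> dist C D = dist D A \<and>
     vertex_angle D A B = pi / 2 \<and> vertex_angle A B C = pi / 2 \<and>
     vertex_angle B C D = pi / 2 \<and> vertex_angle C D A = pi / 2"

end

theory Submission
  imports Defs
begin

text \<open>
  Subtracting the equations of a central configuration at two bodies \<open>i\<close> and \<open>j\<close> and taking the
  wedge product with \<open>q\<^sub>i - q\<^sub>j\<close> eliminates both the multiplier and the centre of mass, leaving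
  the Laura--Andoyer equation. In a quadrilateral central configuration \<open>ABCD\<close> with \<open>DA = DC\<close>
  the equation for the pair \<open>A, C\<close> retains only the term of \<open>B\<close>, so that \<open>BA = BC\<close>. If three sides
  of an isosceles trapezoid are equal, all four therefore are, and a rhombus with equal
  adjacent angles is a square.
\<close>

text \<open>The determinant of two plane vectors, that is, the signed area of the parallelogram they
  span.\<close>

definition wedge :: "real^2 \<Rightarrow> real^2 \<Rightarrow> real" where
  "wedge u v = u $ 1 * v $ 2 - u $ 2 * v $ 1"

lemma linear_wedge: "linear (\<lambda>u. wedge u v)"
  by (rule linearI) (simp_all add: wedge_def algebra_simps)

lemma wedge_scaleR_left: "wedge (c *\<^sub>R u) v = c * wedge u v"
  by (simp add: wedge_def algebra_simps)

lemma wedge_diff_left: "wedge (u - w) v = wedge u v - wedge w v"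
  by (simp add: wedge_def algebra_simps)

text \<open>A zero determinant makes \<open>B - A\<close> proportional to \<open>A - C\<close>. The
  arguments have the form in which the body at \<open>B\<close> enters the Laura-Andoyer equation
  for the pair \<open>A\<close>, \<open>C\<close>.\<close>

lemma collinear_if_wedge_eq_0:
  assumes "wedge (B - A) (A - C) = 0"
  shows "collinear {A, B, C}"
proof (cases "A = C")
  case False
  define u where "u = C - A"
  define v where "v = B - A"
  have "u \<noteq> 0"
    using False by (simp add: u_def)
  then have nz: "u $ 1 \<noteq> 0 \<or> u $ 2 \<noteq> 0"
    by (auto simp: vec_eq_iff forall_2)
  have w: "v $ 1 * u $ 2 = v $ 2 * u $ 1"
    using assms by (simp add: wedge_def u_def v_def algebra_simps)
  have "\<exists>c. v = c *\<^sub>R u"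
  proof (cases "u $ 1 = 0")
    case True
    with nz w have "v = (v $ 2 / u $ 2) *\<^sub>R u"
      by (auto simp: vec_eq_iff forall_2)
    then show ?thesis ..
  next
    case False
    with w have "v = (v $ 1 / u $ 1) *\<^sub>R u"
      by (auto simp: vec_eq_iff forall_2 field_simps)
    then show ?thesis ..
  qed
  then have "collinear {0, u, v}"
    by (auto simp: collinear_lemma)
  then have "collinear {C, A, B}"
    using collinear_3[of C A B] by (simp add: u_def v_def insert_commute)
  then show ?thesis
    by (simp add: insert_commute)
qed (simp add: insert_commute)

text \<open>Among three distinct collinear points one lies strictly between the others, which an
  extreme point cannot do.\<close>

lemma not_collinear_if_extreme_points:
  fixes A B C :: "'a::euclidean_space"
  assumes "A extreme_point_of S" "B extreme_point_of S" "C extreme_point_of S"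
    and "A \<noteq> B" "B \<noteq> C" "A \<noteq> C"
  shows "\<not> collinear {A, B, C}"
proof
  assume "collinear {A, B, C}"
  then have "between (B, C) A \<or> between (C, A) B \<or> between (A, B) C"
    by (simp only: collinear_between_cases)
  then have "A \<in> open_segment B C \<or> B \<in> open_segment C A \<or> C \<in> open_segment A B"
    using assms(4-6) by (auto simp: between_mem_segment open_segment_def)
  then show False
    using assms(1-3) by (auto simp: extreme_point_of_def)
qed

lemma Laura_Andoyer:
  fixes m :: "'n::finite \<Rightarrow> real"
  assumes "central_configuration m q"
  shows "(\<Sum>k\<in>UNIV - {i, j}. m k * (1 / dist (q k) (q i) ^ 3 - 1 / dist (q k) (q j) ^ 3)
            * wedge (q k - q i) (q i - q j)) = 0"
proof (cases "i = j")
  case False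
  obtain l where l: "\<And>k. (\<Sum>h\<in>UNIV - {k}. (m h / norm (q h - q k) ^ 3) *\<^sub>R (q h - q k))
      = - l *\<^sub>R (q k - center_of_mass m q)"
    using assms unfolding central_configuration_def by blast
  let ?w = "\<lambda>u. wedge u (q i - q j)"
  let ?f = "\<lambda>k h. m h / dist (q h) (q k) ^ 3 * ?w (q h - q k)"
  have eq: "(\<Sum>h\<in>UNIV - {k}. ?f k h) = - l * ?w (q k - center_of_mass m q)" for k
  proof -
    have "?w (\<Sum>h\<in>UNIV - {k}. (m h / norm (q h - q k) ^ 3) *\<^sub>R (q h - q k))
        = (\<Sum>h\<in>UNIV - {k}. ?f k h)"
      by (simp add: linear_sum[OF linear_wedge] wedge_scaleR_left dist_norm)
    then show ?thesis
      unfolding l wedge_scaleR_left by simp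
  qed
  \<comment> \<open>The mutual attraction of the pair is parallel to \<open>q i - q j\<close>, so
    the wedge removes it from both equations and leaves the same index set in the two sums.\<close>
  have ij: "?w (q j - q i) = 0" "?w (q i - q j) = 0"
    by (simp_all add: wedge_def algebra_simps)
  have i: "(\<Sum>h\<in>UNIV - {i}. ?f i h) = (\<Sum>h\<in>UNIV - {i, j}. ?f i h)"
    by (rule sum.mono_neutral_right) (auto simp: ij)
  have j: "(\<Sum>h\<in>UNIV - {j}. ?f j h) = (\<Sum>h\<in>UNIV - {i, j}. ?f j h)"
    by (rule sum.mono_neutral_right) (auto simp: ij)
  \<comment> \<open>Moving the base point along \<open>q i - q j\<close> does not change the wedge,
    so both sums share one wedge factor.\<close>
  have shift: "?w (q h - q j) = ?w (q h - q i)" for h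
    by (simp add: wedge_def algebra_simps)
  have "(\<Sum>k\<in>UNIV - {i, j}. m k * (1 / dist (q k) (q i) ^ 3 - 1 / dist (q k) (q j) ^ 3)
            * wedge (q k - q i) (q i - q j))
      = (\<Sum>h\<in>UNIV - {i, j}. ?f i h) - (\<Sum>h\<in>UNIV - {i, j}. ?f j h)"
    unfolding shift sum_subtractf[symmetric] by (rule sum.cong) (simp_all add: algebra_simps)
  also have "\<dots> = - l * (?w (q i - center_of_mass m q) - ?w (q j - center_of_mass m q))"
    unfolding i[symmetric] j[symmetric] eq by (simp add: algebra_simps)
  also have "\<dots> = 0"
    using ij by (simp add: wedge_diff_left)
  finally show ?thesis .
qed (simp add: wedge_def)

lemma central_configuration_kite:
  fixes m :: "'n::finite \<Rightarrow> real"
  assumes cc: "central_configuration m q" and pos: "\<And>k. m k > 0"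
    and range: "range q = {A, B, C, D}" and dist: "distinct [A, B, C, D]"
    and nc: "\<not> collinear {A, B, C}" and eq: "dist D A = dist D C"
  shows "dist B A = dist B C"
proof -
  obtain a b c d where q: "q a = A" "q b = B" "q c = C" "q d = D"
  proof -
    have "A \<in> range q" "B \<in> range q" "C \<in> range q" "D \<in> range q"
      by (simp_all add: range)
    then show ?thesis
      using that by blast
  qed
  have inj: "inj q"
    using cc by (simp add: central_configuration_def)
  \<comment> \<open>By injectivity the four labels exhaust the index type, so the sum for the pair
    \<open>a\<close>, \<open>c\<close> runs over \<open>b\<close> and \<open>d\<close> only.\<close>
  have "k \<in> {a, b, c, d}" for k
    using rangeI[of q k] inj unfolding range q[symmetric] by (auto dest: injD)
  then have "UNIV - {a, c} = {b, d}"
    using dist q by auto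
  moreover have "b \<noteq> d"
    using dist q by auto
  ultimately have "m b * (1 / dist B A ^ 3 - 1 / dist B C ^ 3) * wedge (B - A) (A - C) = 0"
    using Laura_Andoyer[OF cc, of a c] by (simp add: q eq)
  \<comment> \<open>With the mass and the wedge nonzero, only the difference of inverse cubes can
    vanish.\<close>
  moreover have "wedge (B - A) (A - C) \<noteq> 0"
    using nc collinear_if_wedge_eq_0 by blast
  ultimately have "dist B A ^ 3 = dist B C ^ 3"
    using pos[of b] dist by (simp add: field_simps)
  then show ?thesis
    by (simp add: power_eq_iff_eq_base)
qed

text \<open>\<open>B\<close> and \<open>D\<close> lie on the perpendicular bisector of
  \<open>AC\<close>, and \<open>A\<close> and \<open>C\<close> on that of \<open>BD\<close>. Hence
  the diagonals are orthogonal, and both are orthogonal to the vector joining their midpoints, which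
  is \<open>g\<close> up to a scalar.\<close>

lemma parallelogram_if_rhombus:
  fixes A B C D :: "real^2"
  assumes "dist A B = dist B C" "dist B C = dist C D" "dist C D = dist D A"
    and "A \<noteq> C" "B \<noteq> D"
  shows "A + C = B + D"
proof -
  define e where "e = C - A"
  define f where "f = D - B"
  define g where "g = A + C - B - D"
  have norms: "(A - B) \<bullet> (A - B) = (B - C) \<bullet> (B - C)"
    "(B - C) \<bullet> (B - C) = (C - D) \<bullet> (C - D)" "(C - D) \<bullet> (C - D) = (D - A) \<bullet> (D - A)"
    using assms(1-3) by (simp_all add: dist_norm norm_eq)
  \<comment> \<open>In the plane, \<open>g\<close> can be orthogonal to two nonzero orthogonal vectors only if it vanishes.\<close>
  have orth: "e \<bullet> f = 0" "e \<bullet> g = 0" "f \<bullet> g = 0"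
    using norms by (simp_all add: e_def f_def g_def inner_vec_def sum_2 algebra_simps)
  have "e \<noteq> 0" "f \<noteq> 0"
    using assms by (simp_all add: e_def f_def)
  have "g \<bullet> g = 0"
  proof -
    \<comment> \<open>Lagrange's identity: once both terms on the right vanish for a nonzero
      \<open>e\<close>, so does \<open>g\<close>.\<close>
    have id: "(e \<bullet> e) * (g \<bullet> g) = (e \<bullet> g)\<^sup>2 + (wedge e g)\<^sup>2" for e g :: "real^2"
      by (simp add: inner_vec_def sum_2 wedge_def power2_eq_square algebra_simps)
    \<comment> \<open>Expand \<open>g\<close> along \<open>f\<close> and its quarter turn, then take
      the wedge with \<open>e\<close>.\<close>
    have "wedge e g * (f \<bullet> f) = (e \<bullet> f) * wedge f g - wedge f e * (f \<bullet> g)"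
      by (simp add: inner_vec_def sum_2 wedge_def algebra_simps)
    then have "wedge e g = 0"
      using orth \<open>f \<noteq> 0\<close> by simp
    then show ?thesis
      using id[of e g] orth \<open>e \<noteq> 0\<close> by simp
  qed
  then show ?thesis
    unfolding inner_eq_zero_iff by (simp add: g_def algebra_simps)
qed

text \<open>Adjacent angles of a parallelogram are supplementary, so their cosines are
  \<open>x\<close> and \<open>- x\<close>; equal angles force \<open>x = 0\<close>.\<close>

lemma square_if_rhombus_equal_angles:
  assumes convex: "convex_quadrilateral A B C D"
    and sides: "dist A B = dist B C" "dist B C = dist C D" "dist C D = dist D A"
    and angles: "vertex_angle D A B = vertex_angle A B C"
  shows "square A B C D"
proof -
  have neq: "A \<noteq> B" "B \<noteq> C" "A \<noteq> C" "B \<noteq> D"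
    using convex by (auto simp: convex_quadrilateral_def)
  have D: "D = A + C - B"
    using parallelogram_if_rhombus[OF sides neq(3,4)] by (simp add: algebra_simps)
  define x where "x = ((A - B) \<bullet> (C - B)) / (norm (A - B) * norm (C - B))"
  \<comment> \<open>This places \<open>x\<close> and \<open>- x\<close> in the interval where
    \<open>arccos\<close> is injective.\<close>
  have x: "\<bar>x\<bar> \<le> 1"
    using Cauchy_Schwarz_ineq2[of "A - B" "C - B"] neq
    by (simp add: x_def abs_mult divide_le_eq)
  have "(D - A) \<bullet> (B - A) = - ((A - B) \<bullet> (C - B))"
    by (simp add: D algebra_simps inner_commute)
  then have "((D - A) \<bullet> (B - A)) / (norm (D - A) * norm (B - A)) = - x"
    by (simp add: D x_def norm_minus_commute mult.commute)
  then have "arccos (- x) = arccos x"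
    using angles by (simp add: vertex_angle_def x_def)
  then have "- x = x"
    using x arccos_eq_iff[of "- x" x] by simp
  then have "(A - B) \<bullet> (C - B) = 0"
    using neq by (simp add: x_def)
  then have "(D - A) \<bullet> (B - A) = 0" "(A - B) \<bullet> (C - B) = 0" "(B - C) \<bullet> (D - C) = 0"
    "(C - D) \<bullet> (A - D) = 0"
    by (simp_all add: D algebra_simps inner_commute)
  then show ?thesis
    using convex sides by (simp add: square_def vertex_angle_def)
qed

theorem proposition6:
  fixes A B C D :: "real^2"
  assumes "three_sides_equal_trapezoid A B C D"
    and "\<not> square A B C D"
  shows "\<not> (\<exists>(m :: 4 \<Rightarrow> real) (q :: 4 \<Rightarrow> real^2).
            (\<forall>k. m k > 0) \<and> range q = {A, B, C, D} \<and> central_configuration m q)"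
proof
  assume "\<exists>(m :: 4 \<Rightarrow> real) (q :: 4 \<Rightarrow> real^2).
            (\<forall>k. m k > 0) \<and> range q = {A, B, C, D} \<and> central_configuration m q"
  then obtain m :: "4 \<Rightarrow> real" and q :: "4 \<Rightarrow> real^2" where pos: "\<And>k. m k > 0"
    and range: "range q = {A, B, C, D}" and cc: "central_configuration m q"
    by blast
  have convex: "convex_quadrilateral A B C D" and legs: "dist B C = dist D A"
    and angles: "vertex_angle D A B = vertex_angle A B C"
    and three: "\<exists>s. count_list [dist A B, dist B C, dist C D, dist D A] s \<ge> 3"
    using assms(1)
    unfolding three_sides_equal_trapezoid_def isosceles_trapezoid_def trapezoid_def by blast+
  have distinct: "distinct [A, B, C, D]" "distinct [A, D, C, B]"
    using convex by (auto simp: convex_quadrilateral_def)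
  have nc: "\<not> collinear {A, B, C}" "\<not> collinear {A, D, C}"
    using convex distinct(2) not_collinear_if_extreme_points[of _ "convex hull {A, B, C, D}"]
    by (simp_all add: convex_quadrilateral_def)
  have range': "range q = {A, D, C, B}"
    using range by auto
  \<comment> \<open>At most one of the four lengths differs from the common value. The legs are
    equal, so neither is the exception, and some base is as long as the legs.\<close>
  have base: "dist A B = dist B C \<or> dist C D = dist D A"
    using three legs by (auto split: if_splits)
  \<comment> \<open>The kite lemma is applied with \<open>D\<close> and with \<open>B\<close> as the
    equidistant vertex, so whichever base equals the legs, the other one follows.\<close>
  then have "dist A B = dist B C \<and> dist C D = dist D A"
    using central_configuration_kite[OF cc pos range distinct(1) nc(1)]
      central_configuration_kite[OF cc pos range' distinct(2) nc(2)]
    by (auto simp: dist_commute)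
  then have "square A B C D"
    using square_if_rhombus_equal_angles[OF convex _ _ _ angles] legs by simp
  with assms(2) show False ..
qed

end
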